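(* Let $(X,+)$ be a (not necessarily abelian) group and let $f:X\to X$ be a bijective heap endomorphism of $(X,+)$. Define $a\bullet_s b:=f(a)+b$ and $a\bullet_r b:=b+f(a)$ for $a,b\in X$. Then $(X,+,\bullet_s)$ and $(X,+_{op},\bullet_r)$ are left invertible right pre-Lie skew braces.
   Context: For a group $(X,+)$ with neutral element $0$, $a+_{op}b:=b+a$. A map $f:X\to X$ is a heap endomorphism of $(X,+)$ if $f(a-b+c)=f(a)-f(b)+f(c)$ for all $a,b,c\in X$. Let $(X,+)$ be a group and $\bullet:X\times X\to X$ a binary operation. The triple $(X,+,\bullet)$ is a right pre-Lie skew brace if for all $a,b,c\in X$: (1) $a\bullet(b+c)=a\bullet b-a\bullet 0+a\bullet c$ and $(a+b)\bullet c=a\bullet c-0\bullet c+b\bullet c$; (2) $(a\bullet b)\bullet c-a\bullet(b\bullet c)=(a\bullet c)\bullet b-a\bullet(c\bullet b)$. It is left invertible if $(X,\bullet)$ has a left identity, i.e. there is $e\in X$ with $e\bullet b=b$ for all $b\in X$, and for all $b\in X$ there is a unique left inverse $b^{-1}\in X$ with $b^{-1}\bullet b=e$. *)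

theory Defs
  imports "HOL-Algebra.Group"
begin

text \<open>
  The group \<open>(X,+)\<close>, not necessarily abelian, is rendered by a group \<open>G\<close> of HOL-Algebra with
  \<open>X = carrier G\<close>. HOL-Algebra writes groups multiplicatively, so that \<open>a + b\<close>, \<open>0\<close> and \<open>-b\<close> appear
  as \<open>a \<otimes> b\<close>, \<open>\<one>\<close> and \<open>inv b\<close>, and \<open>a - b + c\<close> as \<open>a \<otimes> inv b \<otimes> c\<close>.
\<close>

definition op_group :: "('a, 'b) monoid_scheme \<Rightarrow> ('a, 'b) monoid_scheme" where
  "op_group G = G\<lparr>mult := (\<lambda>a b. b \<otimes>\<^bsub>G\<^esub> a)\<rparr>"

definition heap_endomorphism :: "('a, 'b) monoid_scheme \<Rightarrow> ('a \<Rightarrow> 'a) \<Rightarrow> bool" where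
  "heap_endomorphism G f \<longleftrightarrow>
     f \<in> carrier G \<rightarrow> carrier G \<and>
     (\<forall>a\<in>carrier G. \<forall>b\<in>carrier G. \<forall>c\<in>carrier G.
        f (a \<otimes>\<^bsub>G\<^esub> inv\<^bsub>G\<^esub> b \<otimes>\<^bsub>G\<^esub> c) = f a \<otimes>\<^bsub>G\<^esub> inv\<^bsub>G\<^esub> (f b) \<otimes>\<^bsub>G\<^esub> f c)"

locale right_pre_Lie_skew_brace = group G
  for G :: "('a, 'b) monoid_scheme" (structure) +
  fixes bullet :: "'a \<Rightarrow> 'a \<Rightarrow> 'a" (infixl "\<bullet>" 75)
  assumes bullet_closed: "\<lbrakk>a \<in> carrier G; b \<in> carrier G\<rbrakk> \<Longrightarrow> a \<bullet> b \<in> carrier G"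
    and bullet_right_heap:
      "\<lbrakk>a \<in> carrier G; b \<in> carrier G; c \<in> carrier G\<rbrakk>
        \<Longrightarrow> a \<bullet> (b \<otimes> c) = (a \<bullet> b) \<otimes> inv (a \<bullet> \<one>) \<otimes> (a \<bullet> c)"
    and bullet_left_heap:
      "\<lbrakk>a \<in> carrier G; b \<in> carrier G; c \<in> carrier G\<rbrakk>
        \<Longrightarrow> (a \<otimes> b) \<bullet> c = (a \<bullet> c) \<otimes> inv (\<one> \<bullet> c) \<otimes> (b \<bullet> c)"
    and right_pre_Lie:
      "\<lbrakk>a \<in> carrier G; b \<in> carrier G; c \<in> carrier G\<rbrakk>
        \<Longrightarrow> ((a \<bullet> b) \<bullet> c) \<otimes> inv (a \<bullet> (b \<bullet> c)) = ((a \<bullet> c) \<bullet> b) \<otimes> inv (a \<bullet> (c \<bullet> b))"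

definition left_invertible :: "'a set \<Rightarrow> ('a \<Rightarrow> 'a \<Rightarrow> 'a) \<Rightarrow> bool" where
  "left_invertible X bullet \<longleftrightarrow>
     (\<exists>e\<in>X. (\<forall>b\<in>X. bullet e b = b) \<and> (\<forall>b\<in>X. \<exists>!b'. b' \<in> X \<and> bullet b' b = e))"

locale left_invertible_right_pre_Lie_skew_brace = right_pre_Lie_skew_brace +
  assumes left_invertible: "left_invertible (carrier G) bullet"

end

theory Submission
  imports Defs
begin

text \<open>
  The second structure is an instance of the first: in the opposite group the product of \<open>f a\<close> and
  \<open>b\<close> is \<open>b \<otimes> f a\<close>, and the heap operation \<open>a \<otimes> inv b \<otimes> c\<close> of the opposite group is the original
  one with its outer arguments exchanged, so a heap endomorphism of one group is a heap endomorphism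
  of the other. It therefore suffices to treat the product \<open>f a \<otimes> b\<close> on an arbitrary group.

  There, with \<open>b = \<one>\<close> in the heap law, \<open>f (a \<otimes> c) = f a \<otimes> inv (f \<one>) \<otimes> f c\<close>; this gives
  the distributive law in the left argument of \<open>a \<bullet> b = f a \<otimes> b\<close>, while the one in the right argument
  is cancellation of \<open>f a\<close>. The pre-Lie identity holds because the
  associator \<open>(a \<bullet> b) \<bullet> c \<otimes> inv (a \<bullet> (b \<bullet> c))\<close> equals \<open>f (f a) \<otimes> inv (f \<one>) \<otimes> inv (f a)\<close>: it depends on
  \<open>a\<close> alone, hence is symmetric in \<open>b\<close> and \<open>c\<close>. Bijectivity of \<open>f\<close> serves for left invertibility: the
  left identity is the preimage of \<open>\<one>\<close>, and the left inverse of \<open>b\<close> is the preimage of \<open>e \<otimes> inv b\<close>.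
\<close>

lemma heap_endomorphism_closed:
  assumes "heap_endomorphism G f" "a \<in> carrier G"
  shows "f a \<in> carrier G"
  using assms by (auto simp: heap_endomorphism_def)

context group
begin

lemma heap_endomorphism_mult:
  assumes "heap_endomorphism G f" "a \<in> carrier G" "b \<in> carrier G"
  shows "f (a \<otimes> b) = f a \<otimes> inv (f \<one>) \<otimes> f b"
proof -
  have "f (a \<otimes> inv \<one> \<otimes> b) = f a \<otimes> inv (f \<one>) \<otimes> f b"
    using assms by (simp add: heap_endomorphism_def del: inv_one)
  then show ?thesis using assms by simp
qed

lemma inv_mult_cancel_left:
  assumes "x \<in> carrier G" "y \<in> carrier G"
  shows "inv x \<otimes> (x \<otimes> y) = y" and "x \<otimes> (inv x \<otimes> y) = y"
  using assms by (simp_all add: m_assoc [symmetric])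

text \<open>
  Expanding \<open>f (f a \<otimes> b)\<close> by the heap law puts \<open>f b \<otimes> c\<close> at the right end of \<open>(a \<bullet> b) \<bullet> c\<close>, where it
  cancels against the same factor of \<open>a \<bullet> (b \<bullet> c)\<close>. That \<open>b\<close> and \<open>c\<close> are absent from the right-hand
  side is the pre-Lie identity.
\<close>

lemma heap_endomorphism_associator:
  assumes f: "heap_endomorphism G f"
    and abc: "a \<in> carrier G" "b \<in> carrier G" "c \<in> carrier G"
  shows "(f (f a \<otimes> b) \<otimes> c) \<otimes> inv (f a \<otimes> (f b \<otimes> c)) = f (f a) \<otimes> inv (f \<one>) \<otimes> inv (f a)"
  using abc heap_endomorphism_closed [OF f]
  by (simp add: heap_endomorphism_mult [OF f] m_assoc inv_mult_group inv_mult_cancel_left)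

lemma left_invertible_translate:
  assumes bij: "bij_betw f (carrier G) (carrier G)"
  shows "left_invertible (carrier G) (\<lambda>a b. f a \<otimes> b)"
proof -
  have closed: "f a \<in> carrier G" if "a \<in> carrier G" for a
    using bij that by (rule bij_betwE [THEN bspec])
  have preimage: "\<exists>!a. a \<in> carrier G \<and> f a = y" if "y \<in> carrier G" for y
  proof -
    have "y \<in> f ` carrier G"
      using bij that by (simp add: bij_betw_def)
    then show ?thesis
      using bij_betw_imp_inj_on [OF bij] by (auto dest: inj_onD)
  qed
  obtain e where e: "e \<in> carrier G" "f e = \<one>"
    using preimage [OF one_closed] by blast
  have solve: "f a \<otimes> b = e \<longleftrightarrow> f a = e \<otimes> inv b" if "a \<in> carrier G" "b \<in> carrier G" for a b
    using inv_solve_right [of "f a" e b] that e(1) closed by auto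
  have "\<exists>!b'. b' \<in> carrier G \<and> f b' \<otimes> b = e" if b: "b \<in> carrier G" for b
  proof -
    have "\<exists>!b'. b' \<in> carrier G \<and> f b' = e \<otimes> inv b"
      using preimage e(1) b by simp
    then show ?thesis by (simp add: solve b cong: conj_cong)
  qed
  then show ?thesis
    unfolding left_invertible_def using e by (intro bexI [of _ e]) auto
qed

lemma heap_endomorphism_skew_brace:
  assumes f: "heap_endomorphism G f"
    and bij: "bij_betw f (carrier G) (carrier G)"
  shows "left_invertible_right_pre_Lie_skew_brace G (\<lambda>a b. f a \<otimes> b)"
proof
  note closed = heap_endomorphism_closed [OF f]
  show "left_invertible (carrier G) (\<lambda>a b. f a \<otimes> b)"
    by (rule left_invertible_translate [OF bij])
  fix a b assume ab: "a \<in> carrier G" "b \<in> carrier G"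
  then show "f a \<otimes> b \<in> carrier G"
    using closed by simp
  fix c assume c: "c \<in> carrier G"
  show "f a \<otimes> (b \<otimes> c) = (f a \<otimes> b) \<otimes> inv (f a \<otimes> \<one>) \<otimes> (f a \<otimes> c)"
    using ab c closed by (simp add: m_assoc inv_mult_cancel_left)
  show "f (a \<otimes> b) \<otimes> c = (f a \<otimes> c) \<otimes> inv (f \<one> \<otimes> c) \<otimes> (f b \<otimes> c)"
    using ab c closed
    by (simp add: heap_endomorphism_mult [OF f] m_assoc inv_mult_group inv_mult_cancel_left)
  show "(f (f a \<otimes> b) \<otimes> c) \<otimes> inv (f a \<otimes> (f b \<otimes> c))
      = (f (f a \<otimes> c) \<otimes> b) \<otimes> inv (f a \<otimes> (f c \<otimes> b))"
    using ab c by (simp only: heap_endomorphism_associator [OF f])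
qed

end

lemma op_group_simps [simp]:
  "carrier (op_group G) = carrier G"
  "a \<otimes>\<^bsub>op_group G\<^esub> b = b \<otimes>\<^bsub>G\<^esub> a"
  "\<one>\<^bsub>op_group G\<^esub> = \<one>\<^bsub>G\<^esub>"
  by (simp_all add: op_group_def)

lemma inv_op_group [simp]: "inv\<^bsub>op_group G\<^esub> a = inv\<^bsub>G\<^esub> a"
  by (simp add: m_inv_def conj_commute)

lemma group_op_group:
  assumes "group G"
  shows "group (op_group G)"
proof -
  interpret group G by fact
  show ?thesis
  proof (rule groupI)
    fix x assume "x \<in> carrier (op_group G)"
    then show "\<exists>y\<in>carrier (op_group G). y \<otimes>\<^bsub>op_group G\<^esub> x = \<one>\<^bsub>op_group G\<^esub>"
      by (intro bexI [of _ "inv\<^bsub>G\<^esub> x"]) simp_all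
  qed (simp_all add: m_assoc)
qed

lemma heap_endomorphism_op_group:
  assumes "group G" and f: "heap_endomorphism G f"
  shows "heap_endomorphism (op_group G) f"
proof -
  interpret group G by fact
  show ?thesis
    using f heap_endomorphism_closed [OF f]
    by (auto simp: heap_endomorphism_def m_assoc)
qed

theorem theorem3p28:
  fixes G :: "('a, 'b) monoid_scheme" and f :: "'a \<Rightarrow> 'a"
  assumes "group G"
    and "heap_endomorphism G f"
    and "bij_betw f (carrier G) (carrier G)"
  shows "left_invertible_right_pre_Lie_skew_brace G (\<lambda>a b. f a \<otimes>\<^bsub>G\<^esub> b)
    \<and> left_invertible_right_pre_Lie_skew_brace (op_group G) (\<lambda>a b. b \<otimes>\<^bsub>G\<^esub> f a)"
proof
  show "left_invertible_right_pre_Lie_skew_brace G (\<lambda>a b. f a \<otimes>\<^bsub>G\<^esub> b)"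
    using assms by (rule group.heap_endomorphism_skew_brace)
  show "left_invertible_right_pre_Lie_skew_brace (op_group G) (\<lambda>a b. b \<otimes>\<^bsub>G\<^esub> f a)"
    using group.heap_endomorphism_skew_brace [OF group_op_group heap_endomorphism_op_group, of G f]
      assms by simp
qed

end
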